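(* Let $\mathcal{S}=(\overline{x},\overline{i},\overline{c},I,T)$ be a controllable finite-state transition system with complete and deterministic transition relation $T$, and let $P(\overline{x})$ be a formula of safe states such that the specification $(\mathcal{S},P)$ is realizable. Let $G(\overline{x})$ be a propositional formula over the state variables and let $\mathbf{x}_g$ be a cube over $\overline{x}$. Suppose the quantified Boolean formula \[ \exists \overline{x}^*, \overline{i}^*, \overline{c}^*\,.\, \exists \overline{x}\,.\,\forall \overline{i}\,.\,\exists \overline{c},\overline{x}'\,.\, \Big(I(\overline{x}) \vee \big(G(\overline{x}^* ) \wedge \neg \mathbf{x}_g(\overline{x}^* ) \wedge T(\overline{x}^*, \overline{i}^*, \overline{c}^*, \overline{x})\big)\Big) \wedge \mathbf{x}_g(\overline{x}) \wedge G(\overline{x}) \wedge T(\overline{x},\overline{i},\overline{c},\overline{x}') \wedge G(\overline{x}') \] is unsatisfiable (false), where $\overline{x}^*,\overline{i}^*,\overline{c}^*$ are fresh copies of $\overline{x},\overline{i},\overline{c}$. Then for every winning region $W(\overline{x})$ with $W\Rightarrow G$ and $W \Rightarrow \mathrm{F}^1_{\mathcal{S}}(W)$, and every implementation $\mathcal{I}$ derived from $W$, there is no state $\mathbf{x}_a$ with $\mathbf{x}_a\models G\wedge \mathbf{x}_g$ such that both (a) the protagonist can enforce to visit $G$ in one step from $\mathbf{x}_a$, i.e. $\mathbf{x}_a \models \mathrm{F}^1_{\mathcal{S}}(G)$, and (b) $\mathbf{x}_a$ is reachable in $\mathcal{I}$.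
   Context: A controllable finite-state transition system is a tuple $\mathcal{S}=(\overline{x},\overline{i},\overline{c},I,T)$ where $\overline{x}$ are Boolean state variables, $\overline{i}$ uncontrollable input variables, $\overline{c}$ controllable input variables, $I(\overline{x})$ the initial condition, and $T(\overline{x},\overline{i},\overline{c},\overline{x}')$ the transition relation ($\overline{x}'$ the next-state copy of $\overline{x}$). $T$ is assumed complete and deterministic: for every state and input assignment there is exactly one successor. A state is an $\overline{x}$-minterm (full assignment); a formula over $\overline{x}$ denotes the set of states satisfying it; $F'$ denotes $F$ with all variables replaced by next-state copies. A cube is a conjunction of literals; for a cube $\mathbf{x}_g$ over $\overline{x}$, $\mathbf{x}_g(\overline{x}^* )$ means the same cube over the copy $\overline{x}^*$. An execution is a sequence of states $\mathbf{x}_0,\mathbf{x}_1,\dots$ with $\mathbf{x}_0\models I$ and for each $j$ some inputs $\mathbf{i}_j,\mathbf{c}_j$ with $\mathbf{x}_j\wedge\mathbf{i}_j\wedge\mathbf{c}_j\wedge\mathbf{x}_{j+1}'\models T$; a state is reachable if it occurs in some execution. In each step the antagonist picks $\overline{i}$, then the protagonist picks $\overline{c}$. $\mathrm{F}^1_{\mathcal{S}}(F) := \forall\overline{i}\,.\,\exists\overline{c},\overline{x}'\,.\,T\wedge F'$ (states from which the protagonist can enforce reaching $F$ in one step). A controller is a function $f$ from assignments of $(\overline{x},\overline{i})$ to assignments of $\overline{c}$. Given a safe-state formula $P(\overline{x})$, the specification $(\mathcal{S},P)$ is realizable if there exists a controller $f$ such that every execution of $\mathcal{S}$ in which the controllable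 inputs are chosen as $\mathbf{c}_j=f(\mathbf{x}_j,\mathbf{i}_j)$ visits only states satisfying $P$. A winning region is a formula $W(\overline{x})$ with $I\Rightarrow W$, $W\Rightarrow P$, and $W\Rightarrow \mathrm{F}^1_{\mathcal{S}}(W)$. An implementation derived from $W$ is the transition system $\mathcal{I}=(\overline{x},\overline{i},\emptyset,I,T(\overline{x},\overline{i},f(\overline{x},\overline{i}),\overline{x}'))$ for a controller $f$ that, from every state in $W$ and for every input $\overline{i}$, chooses $\overline{c}$ so that the successor state again satisfies $W$; reachability in $\mathcal{I}$ is defined as for $\mathcal{S}$. *)

theory Defs
  imports Main "HOL-Library.FuncSet"
begin

text \<open>
  A formula over a finite set of Boolean variables is represented by the predicate it induces on
  full assignments. Variables are taken from carrier sets (rather than from whole types), so that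
  each group of variables may be empty; in particular, an implementation is again a transition
  system, with no controllable inputs. Assignments are extensional functions, so that
  \<open>minterms V\<close> is in bijection with the minterms over \<open>V\<close>.
\<close>

type_synonym 'v asg = "'v \<Rightarrow> bool"

definition minterms :: "'v set \<Rightarrow> 'v asg set" where
  "minterms V = V \<rightarrow>\<^sub>E (UNIV :: bool set)"

record ('x, 'i, 'c) ts =
  state_vars :: "'x set"
  input_vars :: "'i set"
  ctrl_vars :: "'c set"
  init_cond :: "'x asg \<Rightarrow> bool"
  trans_rel :: "'x asg \<Rightarrow> 'i asg \<Rightarrow> 'c asg \<Rightarrow> 'x asg \<Rightarrow> bool"

definition states :: "('x, 'i, 'c) ts \<Rightarrow> 'x asg set" where
  "states S = minterms (state_vars S)"

definition inputs :: "('x, 'i, 'c) ts \<Rightarrow> 'i asg set" where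
  "inputs S = minterms (input_vars S)"

definition ctrls :: "('x, 'i, 'c) ts \<Rightarrow> 'c asg set" where
  "ctrls S = minterms (ctrl_vars S)"

definition finite_state_ts :: "('x, 'i, 'c) ts \<Rightarrow> bool" where
  "finite_state_ts S \<longleftrightarrow>
     finite (state_vars S) \<and> finite (input_vars S) \<and> finite (ctrl_vars S)"

definition complete_deterministic :: "('x, 'i, 'c) ts \<Rightarrow> bool" where
  "complete_deterministic S \<longleftrightarrow>
     (\<forall>x \<in> states S. \<forall>i \<in> inputs S. \<forall>c \<in> ctrls S.
        \<exists>!x'. x' \<in> states S \<and> trans_rel S x i c x')"

text \<open>A literal \<open>(v, True)\<close> stands for \<open>v\<close>, and \<open>(v, False)\<close> for its negation.\<close>

type_synonym 'v cube = "('v \<times> bool) set"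

definition cube_over :: "'v set \<Rightarrow> 'v cube \<Rightarrow> bool" where
  "cube_over V C \<longleftrightarrow> finite C \<and> fst ` C \<subseteq> V"

definition cube_holds :: "'v cube \<Rightarrow> 'v asg \<Rightarrow> bool" where
  "cube_holds C a \<longleftrightarrow> (\<forall>(v, b) \<in> C. a v = b)"

definition execution_via ::
  "('x, 'i, 'c) ts \<Rightarrow> (nat \<Rightarrow> 'x asg) \<Rightarrow> (nat \<Rightarrow> 'i asg) \<Rightarrow> (nat \<Rightarrow> 'c asg) \<Rightarrow> bool" where
  "execution_via S xs is cs \<longleftrightarrow>
     init_cond S (xs 0) \<and>
     (\<forall>j. xs j \<in> states S \<and> is j \<in> inputs S \<and> cs j \<in> ctrls S \<and>
          trans_rel S (xs j) (is j) (cs j) (xs (Suc j)))"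

definition execution :: "('x, 'i, 'c) ts \<Rightarrow> (nat \<Rightarrow> 'x asg) \<Rightarrow> bool" where
  "execution S xs \<longleftrightarrow> (\<exists>is cs. execution_via S xs is cs)"

definition reachable :: "('x, 'i, 'c) ts \<Rightarrow> 'x asg \<Rightarrow> bool" where
  "reachable S x \<longleftrightarrow> (\<exists>xs j. execution S xs \<and> xs j = x)"

definition force1 :: "('x, 'i, 'c) ts \<Rightarrow> ('x asg \<Rightarrow> bool) \<Rightarrow> 'x asg \<Rightarrow> bool" where
  "force1 S F x \<longleftrightarrow>
     (\<forall>i \<in> inputs S. \<exists>c \<in> ctrls S. \<exists>x' \<in> states S. trans_rel S x i c x' \<and> F x')"

definition controller :: "('x, 'i, 'c) ts \<Rightarrow> ('x asg \<Rightarrow> 'i asg \<Rightarrow> 'c asg) \<Rightarrow> bool" where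
  "controller S f \<longleftrightarrow> (\<forall>x \<in> states S. \<forall>i \<in> inputs S. f x i \<in> ctrls S)"

definition realizable :: "('x, 'i, 'c) ts \<Rightarrow> ('x asg \<Rightarrow> bool) \<Rightarrow> bool" where
  "realizable S P \<longleftrightarrow>
     (\<exists>f. controller S f \<and>
        (\<forall>xs is cs. execution_via S xs is cs \<and> (\<forall>j. cs j = f (xs j) (is j))
           \<longrightarrow> (\<forall>j. P (xs j))))"

definition form_implies ::
  "('x, 'i, 'c) ts \<Rightarrow> ('x asg \<Rightarrow> bool) \<Rightarrow> ('x asg \<Rightarrow> bool) \<Rightarrow> bool" where
  "form_implies S F H \<longleftrightarrow> (\<forall>x \<in> states S. F x \<longrightarrow> H x)"

definition winning_region ::
  "('x, 'i, 'c) ts \<Rightarrow> ('x asg \<Rightarrow> bool) \<Rightarrow> ('x asg \<Rightarrow> bool) \<Rightarrow> bool" where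
  "winning_region S P W \<longleftrightarrow>
     form_implies S (init_cond S) W \<and> form_implies S W P \<and> form_implies S W (force1 S W)"

definition controlled ::
  "('x, 'i, 'c) ts \<Rightarrow> ('x asg \<Rightarrow> 'i asg \<Rightarrow> 'c asg) \<Rightarrow> ('x, 'i, 'c) ts" where
  "controlled S f =
     \<lparr> state_vars = state_vars S, input_vars = input_vars S, ctrl_vars = {},
       init_cond = init_cond S,
       trans_rel = (\<lambda>x i _ x'. trans_rel S x i (f x i) x') \<rparr>"

definition implementation_from ::
  "('x, 'i, 'c) ts \<Rightarrow> ('x asg \<Rightarrow> bool) \<Rightarrow> ('x, 'i, 'c) ts \<Rightarrow> bool" where
  "implementation_from S W J \<longleftrightarrow>
     (\<exists>f. controller S f \<and>
        (\<forall>x \<in> states S. W x \<longrightarrow>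
           (\<forall>i \<in> inputs S. \<forall>x' \<in> states S. trans_rel S x i (f x i) x' \<longrightarrow> W x')) \<and>
        J = controlled S f)"

end

theory Submission
  imports Defs
begin

text \<open>
  Every state reachable in an implementation derived from \<open>W\<close> lies in \<open>W\<close>, hence satisfies \<open>G\<close>
  and \<open>F\<^sup>1(G)\<close>. Such a state can therefore not be the first one along an execution that lies in the
  cube: it would be initial, or the successor of a \<open>G\<close>-state outside the cube, and either way it
  would satisfy the formula assumed to be false. So no reachable state lies in the cube at all.
\<close>

lemma minterms_nonempty: "minterms V \<noteq> {}"
  by (simp add: minterms_def PiE_eq_empty_iff)

lemma force1_mono:
  assumes "form_implies S F H" "force1 S F x"
  shows "force1 S H x"
  using assms unfolding form_implies_def force1_def by blast

text \<open>An implementation has no controllable variables, so the control sequence of its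
  execution carries no information. The controls applied in \<open>S\<close> are the values of
  \<open>f\<close>, and \<open>controller S f\<close> places them in \<open>ctrls S\<close>.\<close>

lemma execution_controlledE:
  assumes "execution (controlled S f) xs" "controller S f"
  obtains "is" where "execution_via S xs is (\<lambda>j. f (xs j) (is j))"
  using assms
  by (auto simp: execution_def execution_via_def controlled_def controller_def states_def inputs_def)

lemma execution_via_invariant:
  assumes "execution_via S xs is cs"
    and "\<And>x. x \<in> states S \<Longrightarrow> init_cond S x \<Longrightarrow> Q x"
    and "\<And>j. Q (xs j) \<Longrightarrow> Q (xs (Suc j))"
  shows "Q (xs j)"
  using assms by (induction j) (auto simp: execution_via_def)

theorem theorem1:
  fixes S :: "('x, 'i, 'c) ts"
    and P G :: "'x asg \<Rightarrow> bool"
    and xg :: "'x cube"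
  assumes "finite_state_ts S"
    and "complete_deterministic S"
    and "realizable S P"
    and "cube_over (state_vars S) xg"
    and "\<not> (\<exists>x\<^sub>s \<in> states S. \<exists>i\<^sub>s \<in> inputs S. \<exists>c\<^sub>s \<in> ctrls S.
              \<exists>x \<in> states S. \<forall>i \<in> inputs S. \<exists>c \<in> ctrls S. \<exists>x' \<in> states S.
                (init_cond S x \<or>
                   (G x\<^sub>s \<and> \<not> cube_holds xg x\<^sub>s \<and> trans_rel S x\<^sub>s i\<^sub>s c\<^sub>s x)) \<and>
                cube_holds xg x \<and> G x \<and> trans_rel S x i c x' \<and> G x')"
  shows "\<forall>W J. winning_region S P W \<and> form_implies S W G \<and> form_implies S W (force1 S W) \<and>
               implementation_from S W J \<longrightarrow>
           \<not> (\<exists>x\<^sub>a \<in> states S. G x\<^sub>a \<and> cube_holds xg x\<^sub>a \<and> force1 S G x\<^sub>a \<and> reachable J x\<^sub>a)"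
proof (intro allI impI notI)
  fix W J
  assume W: "winning_region S P W \<and> form_implies S W G \<and> form_implies S W (force1 S W) \<and>
      implementation_from S W J"
    and "\<exists>x\<^sub>a \<in> states S. G x\<^sub>a \<and> cube_holds xg x\<^sub>a \<and> force1 S G x\<^sub>a \<and> reachable J x\<^sub>a"
  then obtain xs k where xs: "execution J xs" and cube: "cube_holds xg (xs k)"
    unfolding reachable_def by blast
  obtain f where f: "controller S f" "J = controlled S f"
    and keep: "\<And>x i x'. x \<in> states S \<Longrightarrow> W x \<Longrightarrow> i \<in> inputs S \<Longrightarrow> x' \<in> states S \<Longrightarrow>
      trans_rel S x i (f x i) x' \<Longrightarrow> W x'"
    using W unfolding implementation_from_def by blast
  obtain "is" where exec: "execution_via S xs is (\<lambda>j. f (xs j) (is j))"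
    using execution_controlledE xs f by blast
  then have dom: "xs j \<in> states S" "is j \<in> inputs S" "f (xs j) (is j) \<in> ctrls S"
    and step: "trans_rel S (xs j) (is j) (f (xs j) (is j)) (xs (Suc j))"
    and init: "init_cond S (xs 0)" for j
    unfolding execution_via_def by auto
  have "W (xs j)" for j
    using exec
  proof (rule execution_via_invariant)
    show "W x" if "x \<in> states S" "init_cond S x" for x
      using W that unfolding winning_region_def form_implies_def by blast
    show "W (xs (Suc j))" if "W (xs j)" for j
      using keep dom step that by blast
  qed
  \<comment> \<open>From \<open>W\<close> each state inherits \<open>force1 S W\<close>, which
    weakens to \<open>force1 S G\<close> since \<open>W\<close> implies \<open>G\<close>.\<close>
  then have G: "G (xs j)" and F: "force1 S G (xs j)" for j
    using W dom force1_mono[of S W G] unfolding form_implies_def by blast+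
  \<comment> \<open>For an initial \<open>x\<close> the starred variables are unconstrained, but still need some value.\<close>
  have no_entry: "\<not> cube_holds xg x"
    if x: "x \<in> states S" "G x" "force1 S G x"
      "init_cond S x \<or> (\<exists>y \<in> states S. \<exists>i \<in> inputs S. \<exists>c \<in> ctrls S.
        G y \<and> \<not> cube_holds xg y \<and> trans_rel S y i c x)" for x
  proof
    assume "cube_holds xg x"
    obtain i0 c0 where "i0 \<in> inputs S" "c0 \<in> ctrls S"
      unfolding inputs_def ctrls_def
      using minterms_nonempty[of "input_vars S"] minterms_nonempty[of "ctrl_vars S"] by blast
    \<comment> \<open>If \<open>x\<close> is initial, \<open>x\<close> itself can serve as
      \<open>y\<close>, with \<open>i0\<close> and \<open>c0\<close> as inputs.\<close>
    then obtain y i c where yic: "y \<in> states S" "i \<in> inputs S" "c \<in> ctrls S"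
      and entry: "init_cond S x \<or> (G y \<and> \<not> cube_holds xg y \<and> trans_rel S y i c x)"
      using x(1,4) by blast
    \<comment> \<open>The entry condition, the cube and \<open>G x\<close> do not mention
      \<open>i'\<close>, \<open>c'\<close> or \<open>x'\<close>, so they can be moved under the
      quantifiers of \<open>force1 S G x\<close>.\<close>
    have "\<forall>i' \<in> inputs S. \<exists>c' \<in> ctrls S. \<exists>x' \<in> states S.
        (init_cond S x \<or> (G y \<and> \<not> cube_holds xg y \<and> trans_rel S y i c x)) \<and>
        cube_holds xg x \<and> G x \<and> trans_rel S x i' c' x' \<and> G x'"
      using entry \<open>cube_holds xg x\<close> x(2,3) unfolding force1_def by simp
    with yic x(1) show False
      by - (rule notE[OF assms(5)], intro bexI)
  qed
  have "\<not> cube_holds xg (xs j)" for j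
  proof (induction j)
    case 0
    show ?case using no_entry dom G F init by blast
  next
    case (Suc j)
    \<comment> \<open>The induction hypothesis puts the predecessor \<open>xs j\<close> outside the
      cube, as the second disjunct of the entry condition demands.\<close>
    show ?case using no_entry[OF dom(1) G F] Suc.IH dom G step by blast
  qed
  with cube show False by blast
qed

end
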